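(* Let $n\ge 6$ and let $G\in\mathcal{B}(n,n-2)$ with $G\neq B_n^1$ (i.e. $G$ not isomorphic to $B_n^1$). Then $ME(G)>ME(B_n^1)$.
   Context: All graphs are finite, simple, undirected, and (unless obtained by deletions) connected. For a graph $G$ of order $n$, $m_k(G)$ is the number of $k$-matchings (sets of $k$ pairwise disjoint edges), $m_0(G)=1$. The matching polynomial is $\alpha(G,\mu)=\sum_{k\ge 0}(-1)^k m_k(G)\mu^{n-2k}$; if $\mu_1,\dots,\mu_n$ are its zeros, the matching energy is $ME(G)=\sum_{i=1}^n|\mu_i|$. Equivalently, $ME(G)=\frac{2}{\pi}\int_0^\infty \frac{1}{x^2}\ln\big[\sum_{k\ge 0}m_k(G)x^{2k}\big]dx$. A bicyclic graph is a connected graph with $n$ vertices and $n+1$ edges; $\mathcal{B}(n,d)$ is the class of bicyclic graphs with $n$ vertices and diameter $d$. For $0\le s\le\lfloor n/2\rfloor-2$, $B_n^s$ is the graph on $n$ vertices consisting of a path $u_0u_1\cdots u_{d}$ with $d=n-2$ together with one further vertex $w$ adjacent exactly to $u_s,u_{s+1},u_{s+2}$ (equivalently: attach paths with $s$ and $n-4-s$ vertices to the two non-adjacent vertices of $K_4-e$, respectively). In particular $B_n^1$ is the case $s=1$. *)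

theory Defs
  imports
    "HOL-Computational_Algebra.Computational_Algebra"
    "HOL-Library.Disjoint_Sets"
begin

record 'a graph =
  verts :: "'a set"
  edges :: "'a set set"

definition simple_graph :: "'a graph \<Rightarrow> bool" where
  "simple_graph G \<longleftrightarrow>
     finite (verts G) \<and> (\<forall>e\<in>edges G. e \<subseteq> verts G \<and> card e = 2)"

definition graph_iso :: "'a graph \<Rightarrow> 'b graph \<Rightarrow> bool" where
  "graph_iso G H \<longleftrightarrow>
     (\<exists>f. bij_betw f (verts G) (verts H) \<and>
       (\<forall>x\<in>verts G. \<forall>y\<in>verts G. {x, y} \<in> edges G \<longleftrightarrow> {f x, f y} \<in> edges H))"

definition walk :: "'a graph \<Rightarrow> 'a \<Rightarrow> 'a \<Rightarrow> 'a list \<Rightarrow> bool" where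
  "walk G u v p \<longleftrightarrow>
     p \<noteq> [] \<and> hd p = u \<and> last p = v \<and> set p \<subseteq> verts G \<and>
     successively (\<lambda>x y. {x, y} \<in> edges G) p"

definition connected_graph :: "'a graph \<Rightarrow> bool" where
  "connected_graph G \<longleftrightarrow>
     verts G \<noteq> {} \<and> (\<forall>u\<in>verts G. \<forall>v\<in>verts G. \<exists>p. walk G u v p)"

text \<open>A walk is given by its vertices, so its length is one less than that of the list.
  Distance and diameter are only meaningful for connected (finite) graphs.\<close>

definition graph_dist :: "'a graph \<Rightarrow> 'a \<Rightarrow> 'a \<Rightarrow> nat" where
  "graph_dist G u v = (LEAST l. \<exists>p. walk G u v p \<and> length p = Suc l)"

definition graph_diameter :: "'a graph \<Rightarrow> nat" where
  "graph_diameter G = Max {graph_dist G u v |u v. u \<in> verts G \<and> v \<in> verts G}"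

definition bicyclic :: "'a graph \<Rightarrow> bool" where
  "bicyclic G \<longleftrightarrow>
     simple_graph G \<and> connected_graph G \<and> card (edges G) = card (verts G) + 1"

definition bicyclic_class :: "nat \<Rightarrow> nat \<Rightarrow> 'a graph set" where
  "bicyclic_class n d = {G. bicyclic G \<and> card (verts G) = n \<and> graph_diameter G = d}"

definition k_matchings :: "'a graph \<Rightarrow> nat \<Rightarrow> 'a set set set" where
  "k_matchings G k = {M. M \<subseteq> edges G \<and> disjoint M \<and> card M = k}"

definition matching_number :: "'a graph \<Rightarrow> nat \<Rightarrow> nat" where
  "matching_number G k = card (k_matchings G k)"

text \<open>A \<open>k\<close>-matching covers \<open>2 * k\<close> vertices, so the sum over all \<open>k\<close> stops at half the order
  and the subtraction in the exponent never truncates.\<close>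

definition matching_poly :: "'a graph \<Rightarrow> complex poly" where
  "matching_poly G =
     (\<Sum>k\<le>card (verts G) div 2.
        monom ((- 1) ^ k * of_nat (matching_number G k)) (card (verts G) - 2 * k))"

definition matching_energy :: "'a graph \<Rightarrow> real" where
  "matching_energy G = (\<Sum>z\<in>#proots (matching_poly G). cmod z)"

text \<open>The vertices \<open>0, \<dots>, n - 2\<close> are the path \<open>u\<^sub>0, \<dots>, u\<^bsub>n-2\<^esub>\<close>, and \<open>n - 1\<close> is the further
  vertex \<open>w\<close>. The definition is meant for \<open>n \<ge> 4\<close> and \<open>s \<le> n div 2 - 2\<close>.\<close>

definition B_graph :: "nat \<Rightarrow> nat \<Rightarrow> nat graph" where
  "B_graph n s =
     \<lparr>verts = {..<n},
      edges = {{i, i + 1} |i. i + 1 \<le> n - 2} \<union>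
              {{n - 1, s}, {n - 1, s + 1}, {n - 1, s + 2}}\<rparr>"

end

theory Submission
  imports Defs "HOL-Real_Asymp.Real_Asymp"
begin

text \<open>A connected graph of order \<open>n\<close> and diameter \<open>n - 2\<close> consists of an induced path on \<open>n - 1\<close> vertices (a shortest
  walk between two vertices at maximal distance) and a single further vertex \<open>w\<close>. Having \<open>n + 1\<close> edges
  leaves three edges for \<open>w\<close>, and since a detour through \<open>w\<close> must not shorten the path, the three
  neighbours are consecutive. So the graph is some \<open>B_graph n s\<close>
  (\<open>bicyclic_class_graph_iso_B_graph\<close>), where \<open>s\<close> and \<open>t = n - 4 - s\<close> may be exchanged by
  reflecting the path.

  Let \<open>p\<^sub>k\<close> be the matching generating function \<open>\<Sum>\<^sub>M y\<^bsup>|M|\<^esup>\<close> of the path on \<open>k\<close> vertices. The edges at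
  \<open>w\<close> are pairwise adjacent, so at most one of them is used by a matching, and the generating function of
  \<open>B_graph n s\<close> is
  \<open>p\<^bsub>n-1\<^esub> + y (p\<^sub>s p\<^bsub>t+2\<^esub> + p\<^bsub>s+1\<^esub> p\<^bsub>t+1\<^esub> + p\<^bsub>s+2\<^esub> p\<^sub>t)\<close>. The Fibonacci-like recurrence of the \<open>p\<^sub>k\<close>
  shows that this exceeds the function of \<open>B_graph n 1\<close> by
  \<open>y\<^sup>3 (1 + y) p\<^bsub>s-2\<^esub> p\<^bsub>t-2\<^esub>\<close> if \<open>s, t \<ge> 2\<close>, and by \<open>y\<^sup>2 (1 + y) p\<^bsub>n-6\<^esub>\<close> if \<open>s = 0\<close>. Both are positive
  for \<open>y > 0\<close>.

  It remains to see that a pointwise larger generating function \<open>Q\<close> gives a larger energy. At imaginary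
  arguments the matching polynomial is, up to a power of \<open>\<i>\<close>, \<open>x\<^sup>n Q (1 / x\<^sup>2)\<close>; multiplying its values at
  \<open>\<i> x\<close> and \<open>- \<i> x\<close> gives \<open>Q (1 / x\<^sup>2)\<^sup>2 = \<Prod>\<^sub>\<mu> (1 + \<mu>\<^sup>2 / x\<^sup>2)\<close>. This is at most
  \<open>\<Prod>\<^sub>\<mu> (1 + |\<mu>|\<^sup>2 / x\<^sup>2)\<close>, with equality if all zeros \<open>\<mu>\<close> are real. The sum \<open>\<Sum>\<^sub>\<mu> |\<mu>|\<close> is recovered from
  the last product by Coulson's formula \<open>\<pi> r = \<integral>\<^sub>0\<^sup>\<infinity> ln (1 + r\<^sup>2 / x\<^sup>2) dx\<close>, which is used through an
  explicit antiderivative (\<open>sum_mset_less_of_prod_mset_less\<close>). Since the bound has to be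
  an equality for the graph with the smaller energy, the zeros of that graph must be real
  (\<open>matching_energy_less\<close>). For \<open>B_graph n s\<close> they are obtained as in
  the theorem of Heilmann and Lieb: in the upper half-plane, the quotient of the matching polynomials of
  a graph and of the graph without one vertex has positive imaginary part
  (\<open>matching_poly_B_graph_real_roots\<close>).\<close>

section \<open>A product comparison that forces a comparison of sums\<close>

text \<open>The antiderivative of \<open>ln (1 + r\<^sup>2 / x\<^sup>2)\<close> in \<open>x\<close> on the positive half-line that vanishes at \<open>0\<close>. For
  \<open>r = 0\<close> it is \<open>0\<close>, as it should be, because the factor \<open>r\<close> cancels the undefined quotient \<open>x / r\<close>.\<close>

definition coulson_primitive :: "real \<Rightarrow> real \<Rightarrow> real" where
  "coulson_primitive r x = x * ln (1 + r\<^sup>2 / x\<^sup>2) + 2 * r * arctan (x / r)"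

lemma coulson_primitive_0 [simp]: "coulson_primitive 0 x = 0"
  by (simp add: coulson_primitive_def)

lemma has_field_derivative_coulson_primitive:
  assumes "x > 0" "r \<ge> 0"
  shows "(coulson_primitive r has_real_derivative ln (1 + r\<^sup>2 / x\<^sup>2)) (at x)"
proof (cases "r = 0")
  case True
  have "coulson_primitive 0 = (\<lambda>_. 0)" by (rule ext) simp
  with True show ?thesis by simp
next
  case False
  with assms have r: "r > 0" by simp
  have pos: "1 + r\<^sup>2 / x\<^sup>2 > 0" "x\<^sup>2 + r\<^sup>2 > 0"
    using assms by (auto intro!: add_pos_nonneg)
  have g: "((\<lambda>x. 1 + r\<^sup>2 / x\<^sup>2) has_real_derivative - (2 * r\<^sup>2) / x ^ 3) (at x)"
    using assms by (auto intro!: derivative_eq_intros simp: power2_eq_square power3_eq_cube field_simps)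
  have ln: "((\<lambda>x. ln (1 + r\<^sup>2 / x\<^sup>2)) has_real_derivative
      (- (2 * r\<^sup>2) / x ^ 3) / (1 + r\<^sup>2 / x\<^sup>2)) (at x)"
    using DERIV_chain2[where f = ln and g = "\<lambda>x. 1 + r\<^sup>2 / x\<^sup>2", OF DERIV_ln_divide[OF pos(1)] g]
    by (simp add: mult.commute)
  have h: "((\<lambda>x. x / r) has_real_derivative 1 / r) (at x)"
    using r by (auto intro!: derivative_eq_intros)
  have arctan: "((\<lambda>x. arctan (x / r)) has_real_derivative 1 / r / (1 + (x / r)\<^sup>2)) (at x)"
    using DERIV_chain2[where f = arctan and g = "\<lambda>x. x / r", OF DERIV_arctan h] by (simp add: field_simps)
  have "(coulson_primitive r has_real_derivative
      (ln (1 + r\<^sup>2 / x\<^sup>2) + x * ((- (2 * r\<^sup>2) / x ^ 3) / (1 + r\<^sup>2 / x\<^sup>2)) +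
        2 * r * (1 / r / (1 + (x / r)\<^sup>2)))) (at x)"
    using DERIV_add[OF DERIV_mult[OF DERIV_ident ln] DERIV_cmult[OF arctan, of "2 * r"]]
    unfolding coulson_primitive_def by (simp add: mult_ac add_ac)
  \<comment> \<open>Apart from \<open>ln (1 + r\<^sup>2 / x\<^sup>2)\<close>, the derivatives of the two summands cancel.\<close>
  moreover have "x * ((- (2 * r\<^sup>2) / x ^ 3) / (1 + r\<^sup>2 / x\<^sup>2)) = - (2 * r\<^sup>2 / (x\<^sup>2 + r\<^sup>2))"
    using assms pos by (simp add: divide_simps) (simp add: algebra_simps power2_eq_square power3_eq_cube)
  moreover have "2 * r * (1 / r / (1 + (x / r)\<^sup>2)) = 2 * r\<^sup>2 / (x\<^sup>2 + r\<^sup>2)"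
    using r pos by (simp add: divide_simps power2_eq_square)
  ultimately show ?thesis by simp
qed

lemma tendsto_coulson_primitive_at_right_0:
  assumes "r \<ge> 0"
  shows "(coulson_primitive r \<longlongrightarrow> 0) (at_right 0)"
proof (cases "r = 0")
  case False
  with assms have "r > 0" by simp
  then show ?thesis unfolding coulson_primitive_def by real_asymp
next
  case True
  then have "coulson_primitive r = (\<lambda>_. 0)" by (auto simp: coulson_primitive_def)
  with True show ?thesis by simp
qed

text \<open>Together with the limit \<open>0\<close> at \<open>0\<close> this is Coulson's formula
  \<open>\<pi> r = \<integral>\<^sub>0\<^sup>\<infinity> ln (1 + r\<^sup>2 / x\<^sup>2) dx\<close>.\<close>

lemma tendsto_coulson_primitive_at_top:
  assumes "r \<ge> 0"
  shows "(coulson_primitive r \<longlongrightarrow> pi * r) at_top"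
proof (cases "r = 0")
  case False
  with assms have "r > 0" by simp
  then show ?thesis unfolding coulson_primitive_def by real_asymp
next
  case True
  then have "coulson_primitive r = (\<lambda>_. 0)" by (auto simp: coulson_primitive_def)
  with True show ?thesis by simp
qed

lemma tendsto_sum_mset:
  fixes f :: "'a \<Rightarrow> 'b \<Rightarrow> 'c::topological_comm_monoid_add"
  assumes "\<And>r. r \<in># A \<Longrightarrow> (f r \<longlongrightarrow> l r) F"
  shows "((\<lambda>x. \<Sum>r\<in>#A. f r x) \<longlongrightarrow> (\<Sum>r\<in>#A. l r)) F"
  using assms by (induction A) (auto intro!: tendsto_add)

lemma has_field_derivative_sum_mset_coulson_primitive:
  assumes "x > 0" "\<And>r. r \<in># A \<Longrightarrow> r \<ge> 0"
  shows "((\<lambda>x. \<Sum>r\<in>#A. coulson_primitive r x) has_real_derivative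
            ln (\<Prod>r\<in>#A. 1 + r\<^sup>2 / x\<^sup>2)) (at x)"
    and "(\<Prod>r\<in>#A. 1 + r\<^sup>2 / x\<^sup>2) > 0"
proof -
  have "((\<lambda>x. \<Sum>r\<in>#A. coulson_primitive r x) has_real_derivative
            ln (\<Prod>r\<in>#A. 1 + r\<^sup>2 / x\<^sup>2)) (at x) \<and> (\<Prod>r\<in>#A. 1 + r\<^sup>2 / x\<^sup>2) > 0"
    using assms(2)
  proof (induction A)
    case (add r A)
    have pos: "1 + r\<^sup>2 / x\<^sup>2 > 0" by (auto intro!: add_pos_nonneg)
    from add have IH: "((\<lambda>x. \<Sum>r\<in>#A. coulson_primitive r x) has_real_derivative
            ln (\<Prod>r\<in>#A. 1 + r\<^sup>2 / x\<^sup>2)) (at x)" "(\<Prod>r\<in>#A. 1 + r\<^sup>2 / x\<^sup>2) > 0"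
      by simp_all
    have r: "r \<ge> 0" using add.prems by simp
    show ?case
      using DERIV_add[OF has_field_derivative_coulson_primitive[OF assms(1) r] IH(1)] IH(2) pos
      by (simp add: ln_mult_pos)
  qed simp
  then show "((\<lambda>x. \<Sum>r\<in>#A. coulson_primitive r x) has_real_derivative
            ln (\<Prod>r\<in>#A. 1 + r\<^sup>2 / x\<^sup>2)) (at x)"
    and "(\<Prod>r\<in>#A. 1 + r\<^sup>2 / x\<^sup>2) > 0" by auto
qed

text \<open>The difference of the two sums of antiderivatives has the difference of the logarithms of the two
  products as its derivative, hence is strictly increasing. It starts at \<open>0\<close>, so its limit at infinity,
  \<open>\<pi>\<close> times the difference of the two sums, is positive.\<close>

lemma sum_mset_less_of_prod_mset_less:
  fixes A B :: "real multiset"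
  assumes nonneg: "\<And>r. r \<in># A \<Longrightarrow> r \<ge> 0" "\<And>r. r \<in># B \<Longrightarrow> r \<ge> 0"
    and less: "\<And>x. x > 0 \<Longrightarrow> (\<Prod>r\<in>#B. 1 + r\<^sup>2 / x\<^sup>2) < (\<Prod>r\<in>#A. 1 + r\<^sup>2 / x\<^sup>2)"
  shows "\<Sum>\<^sub># B < \<Sum>\<^sub># A"
proof -
  define D where
    "D = (\<lambda>x. (\<Sum>r\<in>#A. coulson_primitive r x) - (\<Sum>r\<in>#B. coulson_primitive r x))"
  have incr: "D x < D y" if "0 < x" "x < y" for x y
  proof (rule DERIV_pos_imp_increasing[OF \<open>x < y\<close>])
    fix t assume "x \<le> t" "t \<le> y"
    with that have t: "t > 0" by simp
    have "(D has_real_derivative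
        ln (\<Prod>r\<in>#A. 1 + r\<^sup>2 / t\<^sup>2) - ln (\<Prod>r\<in>#B. 1 + r\<^sup>2 / t\<^sup>2)) (at t)"
      unfolding D_def
      by (intro DERIV_diff has_field_derivative_sum_mset_coulson_primitive nonneg t)
    moreover have "ln (\<Prod>r\<in>#B. 1 + r\<^sup>2 / t\<^sup>2) < ln (\<Prod>r\<in>#A. 1 + r\<^sup>2 / t\<^sup>2)"
      using less[OF t] has_field_derivative_sum_mset_coulson_primitive(2)[OF t, of B] nonneg(2)
      by (simp add: order.strict_trans[OF _ less[OF t]])
    ultimately show "\<exists>d. (D has_real_derivative d) (at t) \<and> d > 0" by auto
  qed
  have at_0: "(D \<longlongrightarrow> (\<Sum>r\<in>#A. 0) - (\<Sum>r\<in>#B. 0)) (at_right 0)"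
    unfolding D_def
    by (intro tendsto_diff tendsto_sum_mset tendsto_coulson_primitive_at_right_0 nonneg)
  have at_top: "(D \<longlongrightarrow> (\<Sum>r\<in>#A. pi * r) - (\<Sum>r\<in>#B. pi * r)) at_top"
    unfolding D_def
    by (intro tendsto_diff tendsto_sum_mset tendsto_coulson_primitive_at_top nonneg)
  \<comment> \<open>The detour over \<open>1\<close> and \<open>2\<close> keeps the inequality strict in the limit.\<close>
  have "0 \<le> D 1"
  proof (rule tendsto_upperbound)
    show "(D \<longlongrightarrow> 0) (at_right 0)" using at_0 by simp
    show "eventually (\<lambda>x. D x \<le> D 1) (at_right 0)"
      using eventually_at_right_real[OF zero_less_one]
      by eventually_elim (auto intro: less_imp_le incr)
  qed simp
  also have "D 1 < D 2" by (rule incr) auto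
  also have "D 2 \<le> (\<Sum>r\<in>#A. pi * r) - (\<Sum>r\<in>#B. pi * r)"
  proof (rule tendsto_lowerbound[OF at_top])
    show "eventually (\<lambda>x. D 2 \<le> D x) at_top"
      using eventually_gt_at_top[of 2]
      by eventually_elim (simp add: incr less_imp_le)
  qed simp
  finally show ?thesis
    by (simp add: sum_mset_distrib_left[symmetric] mult_less_cancel_left)
qed

section \<open>The matching generating function\<close>

definition matching_gf :: "'a set set \<Rightarrow> 'b::comm_ring_1 \<Rightarrow> 'b" where
  "matching_gf E y = (\<Sum>M | M \<subseteq> E \<and> disjoint M. y ^ card M)"

lemma matching_gf_empty [simp]: "matching_gf ({} :: 'a set set) y = 1"
proof -
  have eq: "{M :: 'a set set. M \<subseteq> {} \<and> disjoint M} = {{}}" by auto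
  show ?thesis unfolding matching_gf_def eq by simp
qed

text \<open>A matching avoids the edge \<open>e\<close>, or it consists of \<open>e\<close> and a matching of the edges disjoint from \<open>e\<close>.\<close>

lemma matching_gf_insert:
  assumes "finite E" "e \<notin> E"
  shows "matching_gf (insert e E) y =
           matching_gf E y + y * matching_gf {f \<in> E. disjnt e f} y"
proof -
  let ?A = "{M. M \<subseteq> E \<and> disjoint M}"
  let ?B = "{M. M \<subseteq> {f \<in> E. disjnt e f} \<and> disjoint M}"
  have fin: "finite ?A" "finite ?B"
    using assms(1) by (auto intro: finite_subset[of _ "Pow E"])
  have split: "{M. M \<subseteq> insert e E \<and> disjoint M} = ?A \<union> insert e ` ?B"
  proof (intro equalityI subsetI)
    fix M assume M: "M \<in> {M. M \<subseteq> insert e E \<and> disjoint M}"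
    show "M \<in> ?A \<union> insert e ` ?B"
    proof (cases "e \<in> M")
      case True
      then have "M = insert e (M - {e})" by auto
      moreover have "M - {e} \<in> ?B"
        using M True by (auto simp: pairwise_def)
      ultimately show ?thesis by blast
    next
      case False
      with M have "M \<subseteq> E" by blast
      with M show ?thesis by simp
    qed
  next
    fix M assume "M \<in> ?A \<union> insert e ` ?B"
    then consider "M \<in> ?A" | N where "M = insert e N" "N \<in> ?B" by blast
    then show "M \<in> {M. M \<subseteq> insert e E \<and> disjoint M}"
    proof cases
      case 1
      then show ?thesis by blast
    next
      case 2
      then have "disjnt e f \<and> disjnt f e" if "f \<in> N" for f using that disjnt_sym by blast
      moreover have "N \<subseteq> E" using 2 by blast
      ultimately show ?thesis using 2 by (auto simp: pairwise_insert)
    qed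
  qed
  have inj: "inj_on (insert e) ?B"
  proof (rule inj_onI)
    fix M N assume "M \<in> ?B" "N \<in> ?B" "insert e M = insert e N"
    moreover from this have "e \<notin> M" "e \<notin> N" using assms(2) by blast+
    ultimately show "M = N" by (simp add: insert_ident)
  qed
  have "matching_gf (insert e E) y =
      (\<Sum>M\<in>?A. y ^ card M) + (\<Sum>M\<in>insert e ` ?B. y ^ card M)"
    unfolding matching_gf_def split
    by (rule sum.union_disjoint) (use assms(2) fin in auto)
  also have "(\<Sum>M\<in>insert e ` ?B. y ^ card M) = (\<Sum>M\<in>?B. y * y ^ card M)"
    unfolding sum.reindex[OF inj]
  proof (rule sum.cong)
    fix M assume "M \<in> ?B"
    then have "finite M" "e \<notin> M" using assms by (auto intro: finite_subset)
    then show "((\<lambda>M. y ^ card M) \<circ> insert e) M = y * y ^ card M" by simp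
  qed simp
  finally show ?thesis by (simp add: matching_gf_def sum_distrib_left)
qed

text \<open>Induction by deleting an edge of \<open>F\<close>: the edges of \<open>E\<close> are disjoint from it and therefore
  survive in both terms of the deletion formula.\<close>

lemma matching_gf_Un:
  assumes "finite E" "finite F" "E \<inter> F = {}" "\<And>e f. e \<in> E \<Longrightarrow> f \<in> F \<Longrightarrow> disjnt e f"
  shows "matching_gf (E \<union> F) y = matching_gf E y * matching_gf F y"
  using assms(2-4)
proof (induction "card F" arbitrary: F rule: less_induct)
  case less
  show ?case
  proof (cases "F = {}")
    case False
    then obtain e where e: "e \<in> F" by blast
    define F' where "F' = F - {e}"
    have F: "F = insert e F'" "e \<notin> F'" "finite F'" using e less.prems(1) by (auto simp: F'_def)
    let ?F = "{f \<in> F'. disjnt e f}"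
    have lt: "card F' < card F" using F by simp
    have "card ?F \<le> card F'" by (rule card_mono) (use F in auto)
    with lt have lt': "card ?F < card F" by simp
    have E: "{f \<in> E \<union> F'. disjnt e f} = E \<union> ?F"
      using less.prems(3) e disjnt_sym by blast
    have "matching_gf (E \<union> F) y = matching_gf (insert e (E \<union> F')) y" by (simp add: F)
    also have "\<dots> = matching_gf (E \<union> F') y + y * matching_gf (E \<union> ?F) y"
      unfolding E[symmetric]
      by (rule matching_gf_insert) (use less.prems(2) e F assms(1) in auto)
    also have "matching_gf (E \<union> F') y = matching_gf E y * matching_gf F' y"
      by (rule less.hyps[OF lt]) (use less.prems F in auto)
    also have "matching_gf (E \<union> ?F) y = matching_gf E y * matching_gf ?F y"
      by (rule less.hyps[OF lt']) (use less.prems F in auto)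
    also have "matching_gf E y * matching_gf F' y + y * (matching_gf E y * matching_gf ?F y)
        = matching_gf E y * matching_gf F y"
      using F by (simp add: matching_gf_insert algebra_simps)
    finally show ?thesis .
  qed simp
qed

lemma matching_gf_of_real:
  "matching_gf E (complex_of_real y) = complex_of_real (matching_gf E y)"
  by (simp add: matching_gf_def)

lemma matching_gf_nonneg:
  "y \<ge> 0 \<Longrightarrow> matching_gf E (y::real) \<ge> 0"
  unfolding matching_gf_def by (intro sum_nonneg) auto

section \<open>Matching generating functions of paths and of the graphs \<open>B_graph n s\<close>\<close>

text \<open>The generating function of the path on \<open>k\<close> vertices. Indexing by vertices and starting with the empty
  path makes deleting a vertex at the end of a path a special case of deleting any vertex.\<close>

fun path_gf :: "nat \<Rightarrow> 'b::comm_ring_1 \<Rightarrow> 'b" where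
  "path_gf 0 y = 1"
| "path_gf (Suc 0) y = 1"
| "path_gf (Suc (Suc k)) y = path_gf (Suc k) y + y * path_gf k y"

lemma path_gf_pos: "y > 0 \<Longrightarrow> path_gf k (y::real) > 0"
  by (induction k y rule: path_gf.induct) (auto intro: add_pos_pos)

text \<open>The two terms count the matchings without and with the edge that joins the first \<open>a + 1\<close> vertices of
  the path to the last \<open>b + 1\<close>.\<close>

lemma path_gf_add:
  "path_gf (a + b + 2) y = path_gf (a + 1) y * path_gf (b + 1) y + y * path_gf a y * path_gf b y"
proof (induction a y rule: path_gf.induct)
  case (3 a y)
  have "path_gf (Suc (Suc a) + b + 2) y = path_gf (Suc a + b + 2) y + y * path_gf (a + b + 2) y"
    by (simp add: eval_nat_numeral)
  then show ?case
    unfolding 3 by (simp add: algebra_simps)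
qed (simp_all add: eval_nat_numeral algebra_simps)

text \<open>The edges of the path on the vertices \<open>i, \<dots>, j\<close>. It is empty for \<open>j < i\<close> (no vertex) as well as for
  \<open>j = i\<close> (one vertex), in accordance with \<open>path_gf 0 = path_gf 1 = 1\<close>.\<close>

definition path_edges :: "nat \<Rightarrow> nat \<Rightarrow> nat set set" where
  "path_edges i j = (\<lambda>k. {k, Suc k}) ` {i..<j}"

lemma finite_path_edges [simp]: "finite (path_edges i j)"
  by (simp add: path_edges_def)

lemma path_edges_empty [simp]: "j \<le> i \<Longrightarrow> path_edges i j = {}"
  by (simp add: path_edges_def)

lemma mem_path_edges_bounded: "e \<in> path_edges i j \<Longrightarrow> k \<in> e \<Longrightarrow> i \<le> k \<and> k \<le> j"
  by (auto simp: path_edges_def)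

lemma matching_gf_path_edges_add:
  "matching_gf (path_edges i (i + k)) y = path_gf (Suc k) y"
proof (induction k y rule: path_gf.induct)
  case (2 y)
  have "path_edges i (i + Suc 0) = insert {i, Suc i} {}" by (simp add: path_edges_def)
  then show ?case by (simp add: matching_gf_insert)
next
  case (3 k y)
  let ?e = "{i + Suc k, Suc (i + Suc k)}"
  have "path_edges i (i + Suc (Suc k)) = insert ?e (path_edges i (i + Suc k))"
    by (simp add: path_edges_def atLeastLessThanSuc)
  moreover have "?e \<notin> path_edges i (i + Suc k)"
    using mem_path_edges_bounded[of ?e i "i + Suc k" "Suc (i + Suc k)"] by auto
  moreover have "{f \<in> path_edges i (i + Suc k). disjnt ?e f} = path_edges i (i + k)"
    unfolding path_edges_def disjnt_def by (auto simp: less_Suc_eq)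
  ultimately show ?case using 3 by (simp add: matching_gf_insert)
qed simp

text \<open>The bound \<open>i \<le> Suc j\<close> admits the path without vertices.\<close>

lemma matching_gf_path_edges:
  assumes "i \<le> Suc j"
  shows "matching_gf (path_edges i j) y = path_gf (Suc j - i) y"
proof (cases "i = Suc j")
  case False
  with assms obtain k where "j = i + k" by (metis le_SucE le_Suc_ex)
  then show ?thesis using matching_gf_path_edges_add[of i k y] by (simp add: Suc_diff_le)
qed simp

text \<open>The edges that miss \<open>s\<close> form the two paths on either side of \<open>s\<close>.\<close>

lemma matching_gf_path_minus_vertex:
  assumes "s \<le> d" "d < w"
  shows "matching_gf {f \<in> path_edges 0 d. disjnt {w, s} f} y = path_gf s y * path_gf (d - s) y"
proof -
  \<comment> \<open>For \<open>s = 0\<close> the left part is the truncated \<open>path_edges 0 0\<close>, which is empty as required.\<close>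
  have "{f \<in> path_edges 0 d. disjnt {w, s} f} = path_edges 0 (s - 1) \<union> path_edges (Suc s) d"
  proof -
    have "{f \<in> path_edges 0 d. disjnt {w, s} f} =
        (\<lambda>k. {k, Suc k}) ` {k \<in> {0..<d}. disjnt {w, s} {k, Suc k}}"
      unfolding path_edges_def by blast
    also have "{k \<in> {0..<d}. disjnt {w, s} {k, Suc k}} = {0..<s - 1} \<union> {Suc s..<d}"
      using assms by auto
    finally show ?thesis unfolding path_edges_def by (simp add: image_Un)
  qed
  also have "matching_gf \<dots> y = matching_gf (path_edges 0 (s - 1)) y * matching_gf (path_edges (Suc s) d) y"
  proof (rule matching_gf_Un)
    have *: "disjnt e f" if "e \<in> path_edges 0 (s - 1)" "f \<in> path_edges (Suc s) d" for e f
      using mem_path_edges_bounded[OF that(1)] mem_path_edges_bounded[OF that(2)]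
      unfolding disjnt_def by fastforce
    show "disjnt e f" if "e \<in> path_edges 0 (s - 1)" "f \<in> path_edges (Suc s) d" for e f
      using * that .
    have "{} \<notin> path_edges 0 (s - 1)" by (auto simp: path_edges_def)
    then show "path_edges 0 (s - 1) \<inter> path_edges (Suc s) d = {}"
      using * by (metis disjnt_self_iff_empty disjoint_iff)
  qed simp_all
  also have "matching_gf (path_edges 0 (s - 1)) y = path_gf s y"
    by (cases s) (simp_all add: matching_gf_path_edges)
  also have "matching_gf (path_edges (Suc s) d) y = path_gf (d - s) y"
    using assms by (simp add: matching_gf_path_edges)
  finally show ?thesis .
qed

text \<open>The edges at the vertex \<open>w\<close> outside of the path are pairwise adjacent, so the contributions of
  matchings that use one of them simply add up over the neighbours \<open>s\<close> of \<open>w\<close>.\<close>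

lemma matching_gf_path_plus_vertex:
  assumes "finite S" "S \<subseteq> {..d}" "d < w"
  shows "matching_gf (path_edges 0 d \<union> (\<lambda>s. {w, s}) ` S) y =
           path_gf (Suc d) y + y * (\<Sum>s\<in>S. path_gf s y * path_gf (d - s) y)"
  using assms(1,2)
proof (induction S rule: finite_induct)
  case empty
  show ?case by (simp add: matching_gf_path_edges)
next
  case (insert s S)
  let ?E = "path_edges 0 d \<union> (\<lambda>s. {w, s}) ` S"
  have "{w, s} \<notin> path_edges 0 d"
    using mem_path_edges_bounded[of "{w, s}" 0 d w] assms(3) by auto
  then have e: "{w, s} \<notin> ?E" using insert.hyps by (auto simp: doubleton_eq_iff)
  have "matching_gf (path_edges 0 d \<union> (\<lambda>s. {w, s}) ` insert s S) y
      = matching_gf (insert {w, s} ?E) y" by simp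
  also have "\<dots> = matching_gf ?E y + y * matching_gf {f \<in> ?E. disjnt {w, s} f} y"
    using e insert.hyps by (intro matching_gf_insert) auto
  also have "{f \<in> ?E. disjnt {w, s} f} = {f \<in> path_edges 0 d. disjnt {w, s} f}"
    by (auto simp: disjnt_def)
  also have "matching_gf \<dots> y = path_gf s y * path_gf (d - s) y"
    by (rule matching_gf_path_minus_vertex) (use insert.prems assms(3) in auto)
  finally show ?case
    using insert by (simp add: distrib_left add_ac)
qed

lemma matching_gf_B_graph:
  assumes "n = s + t + 4"
  shows "matching_gf (edges (B_graph n s)) y = path_gf (s + t + 3) y +
    y * (path_gf s y * path_gf (t + 2) y + path_gf (s + 1) y * path_gf (t + 1) y
       + path_gf (s + 2) y * path_gf t y)"
proof -
  have "edges (B_graph n s) =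
      path_edges 0 (s + t + 2) \<union> (\<lambda>j. {s + t + 3, j}) ` {s, s + 1, s + 2}"
  proof -
    have "{{i, i + 1} |i. i + 1 \<le> s + t + 2} = path_edges 0 (s + t + 2)"
      by (auto simp: path_edges_def)
    moreover have "n - 1 = s + t + 3" "n - 2 = s + t + 2" using assms by simp_all
    ultimately show ?thesis unfolding B_graph_def by simp
  qed
  also have "matching_gf \<dots> y = path_gf (Suc (s + t + 2)) y +
      y * (\<Sum>j\<in>{s, s + 1, s + 2}. path_gf j y * path_gf (s + t + 2 - j) y)"
    by (rule matching_gf_path_plus_vertex) auto
  also have "(\<Sum>j\<in>{s, s + 1, s + 2}. path_gf j y * path_gf (s + t + 2 - j) y) =
      path_gf s y * path_gf (t + 2) y + path_gf (s + 1) y * path_gf (t + 1) y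
       + path_gf (s + 2) y * path_gf t y"
    by (simp add: add_ac)
  also have "Suc (s + t + 2) = s + t + 3" by simp
  finally show ?thesis .
qed

text \<open>All path functions that occur are polynomials in \<open>y\<close> and in the four values of \<open>path_gf\<close> at \<open>a\<close>,
  \<open>a + 1\<close>, \<open>b\<close> and \<open>b + 1\<close>, by the recurrence and \<open>path_gf_add\<close>. In these terms the claim is a
  polynomial identity.\<close>

lemma matching_gf_B_graph_interior:
  assumes "n = a + b + 8"
  shows "matching_gf (edges (B_graph n (a + 2))) y =
    matching_gf (edges (B_graph n 1)) y + y ^ 3 * (1 + y) * path_gf a y * path_gf b y"
proof -
  define A A' B B' where "A = path_gf a y" "A' = path_gf (a + 1) y" "B = path_gf b y" "B' = path_gf (b + 1) y"
  note AB = this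
  have a: "path_gf (a + 2) y = A' + y * A" "path_gf (a + 3) y = A' + y * A + y * A'"
    "path_gf (a + 4) y = A' + y * A + y * A' + y * (A' + y * A)"
    by (simp_all add: AB eval_nat_numeral)
  have b: "path_gf (b + 2) y = B' + y * B" "path_gf (b + 3) y = B' + y * B + y * B'"
    "path_gf (b + 4) y = B' + y * B + y * B' + y * (B' + y * B)"
    by (simp_all add: AB eval_nat_numeral)
  define C D where "C = path_gf (a + b + 2) y" "D = path_gf (a + b + 3) y"
  note CD = this
  have C: "C = A' * B' + y * A * B"
    unfolding CD AB by (rule path_gf_add)
  have D: "D = A' * (B' + y * B) + y * A * B'"
    using path_gf_add[of a "b + 1" y] b(1) unfolding CD AB by (simp add: eval_nat_numeral add_ac)
  have c: "path_gf (a + b + 4) y = D + y * C" "path_gf (a + b + 5) y = D + y * C + y * D"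
    unfolding CD by (simp_all add: eval_nat_numeral)
  have "path_gf (a + b + 7) y =
      path_gf (a + b + 5) y + y * path_gf (a + b + 4) y + y * path_gf (a + b + 5) y"
    by (simp add: eval_nat_numeral)
  have s: "matching_gf (edges (B_graph n (a + 2))) y = path_gf (a + b + 7) y +
    y * (path_gf (a + 2) y * path_gf (b + 4) y + path_gf (a + 3) y * path_gf (b + 3) y
       + path_gf (a + 4) y * path_gf (b + 2) y)"
    using assms by (subst matching_gf_B_graph[where t = "b + 2"]) (simp_all add: eval_nat_numeral add_ac del: path_gf.simps)
  have 1: "matching_gf (edges (B_graph n 1)) y = path_gf (a + b + 7) y +
    y * (path_gf 1 y * path_gf (a + b + 5) y + path_gf 2 y * path_gf (a + b + 4) y
       + path_gf 3 y * path_gf (a + b + 3) y)"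
    using assms by (subst matching_gf_B_graph[where t = "a + b + 3"]) (simp_all add: eval_nat_numeral add_ac del: path_gf.simps)
  have p: "path_gf 1 y = 1" "path_gf 2 y = 1 + y" "path_gf 3 y = 1 + y + y"
    by (simp_all add: eval_nat_numeral)
  show ?thesis
    unfolding s 1 a b c p CD(2)[symmetric] C D AB(1)[symmetric] AB(3)[symmetric]
    by (simp add: algebra_simps power3_eq_cube)
qed

lemma matching_gf_B_graph_end:
  assumes "n = b + 6"
  shows "matching_gf (edges (B_graph n 0)) y =
    matching_gf (edges (B_graph n 1)) y + y\<^sup>2 * (1 + y) * path_gf b y"
proof -
  have 0: "matching_gf (edges (B_graph n 0)) y = path_gf (b + 5) y +
    y * (path_gf 0 y * path_gf (b + 4) y + path_gf 1 y * path_gf (b + 3) y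
       + path_gf 2 y * path_gf (b + 2) y)"
    using assms by (subst matching_gf_B_graph[where t = "b + 2"]) (simp_all add: eval_nat_numeral add_ac del: path_gf.simps)
  have 1: "matching_gf (edges (B_graph n 1)) y = path_gf (b + 5) y +
    y * (path_gf 1 y * path_gf (b + 3) y + path_gf 2 y * path_gf (b + 2) y
       + path_gf 3 y * path_gf (b + 1) y)"
    using assms by (subst matching_gf_B_graph[where t = "b + 1"]) (simp_all add: eval_nat_numeral add_ac del: path_gf.simps)
  show ?thesis
    unfolding 0 1 by (simp add: eval_nat_numeral algebra_simps)
qed

section \<open>The matching polynomial and the matching energy\<close>

lemma finite_edges: "simple_graph G \<Longrightarrow> finite (edges G)"
  unfolding simple_graph_def by (auto intro: finite_subset[of _ "Pow (verts G)"])

lemma twice_card_matching_le: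
  assumes "simple_graph G" "M \<subseteq> edges G" "disjoint M"
  shows "2 * card M \<le> card (verts G)"
proof -
  have M: "\<Union>M \<subseteq> verts G" "finite (verts G)"
    using assms(1,2) unfolding simple_graph_def by auto
  have e: "card e = 2" "finite e" if "e \<in> M" for e
    using assms(1,2) that finite_subset unfolding simple_graph_def by blast+
  have "card (\<Union>M) = (\<Sum>e\<in>M. card e)"
    using assms(3) e by (intro card_Union_disjoint) (auto simp: pairwise_def)
  also have "\<dots> = 2 * card M" using e by simp
  finally show ?thesis using card_mono[OF M(2,1)] by simp
qed

lemma matching_gf_eq_sum_matching_number:
  assumes "simple_graph G"
  shows "matching_gf (edges G) y =
    (\<Sum>k\<le>card (verts G) div 2. of_nat (matching_number G k) * y ^ k)"
proof -
  let ?A = "{M. M \<subseteq> edges G \<and> disjoint M}"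
  have fin: "finite ?A"
    using finite_edges[OF assms] by (auto intro: finite_subset[of _ "Pow (edges G)"])
  have le: "card ` ?A \<subseteq> {..card (verts G) div 2}"
  proof (rule image_subsetI)
    fix M assume "M \<in> ?A"
    then have "2 * card M \<le> card (verts G)" using twice_card_matching_le[OF assms] by blast
    then show "card M \<in> {..card (verts G) div 2}" by simp
  qed
  have "matching_gf (edges G) y =
      (\<Sum>k\<le>card (verts G) div 2. \<Sum>M\<in>{M \<in> ?A. card M = k}. y ^ card M)"
    unfolding matching_gf_def by (rule sum.group[symmetric, OF fin _ le]) simp
  also have "\<dots> = (\<Sum>k\<le>card (verts G) div 2. of_nat (matching_number G k) * y ^ k)"
  proof (rule sum.cong[OF refl])
    fix k
    have "{M \<in> ?A. card M = k} = k_matchings G k" by (auto simp: k_matchings_def)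
    then show "(\<Sum>M\<in>{M \<in> ?A. card M = k}. y ^ card M) = of_nat (matching_number G k) * y ^ k"
      by (simp add: matching_number_def k_matchings_def)
  qed
  finally show ?thesis .
qed

lemma poly_matching_poly:
  assumes "simple_graph G" "z \<noteq> 0"
  shows "poly (matching_poly G) z = z ^ card (verts G) * matching_gf (edges G) (- 1 / z\<^sup>2)"
proof -
  have "z ^ (card (verts G) - 2 * k) * (- 1) ^ k = z ^ card (verts G) * (- 1 / z\<^sup>2) ^ k"
    if "k \<le> card (verts G) div 2" for k
  proof -
    have "2 * k \<le> card (verts G)" using that by simp
    then have "z ^ (card (verts G) - 2 * k) = z ^ card (verts G) / (z\<^sup>2) ^ k"
      using assms(2) by (simp add: power_diff power_mult)
    then show ?thesis by (simp only: power_divide times_divide_eq_left times_divide_eq_right)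
  qed
  then show ?thesis
    unfolding matching_gf_eq_sum_matching_number[OF assms(1)] matching_poly_def poly_sum poly_monom
      sum_distrib_left
    by (intro sum.cong) (simp_all add: mult_ac)
qed

text \<open>All exponents in the matching polynomial have the parity of the order of the graph. This spares a
  separate argument for the lower half-plane.\<close>

lemma poly_matching_poly_minus:
  "poly (matching_poly G) (- z) = (- 1) ^ card (verts G) * poly (matching_poly G) z"
proof -
  have "(- z) ^ (card (verts G) - 2 * k) = (- 1) ^ card (verts G) * z ^ (card (verts G) - 2 * k)"
    if "k \<le> card (verts G) div 2" for k
  proof -
    have "even (card (verts G) - 2 * k) \<longleftrightarrow> even (card (verts G))" using that by auto
    then show ?thesis by (auto simp: power_minus')
  qed
  then show ?thesis
    unfolding matching_poly_def poly_sum poly_monom sum_distrib_left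
    by (intro sum.cong) (simp_all add: mult_ac)
qed

lemma matching_number_0:
  assumes "simple_graph G"
  shows "matching_number G 0 = 1"
proof -
  have "k_matchings G 0 = {{}}"
    using finite_edges[OF assms] by (auto simp: k_matchings_def dest: finite_subset)
  then show ?thesis by (simp add: matching_number_def)
qed

lemma monic_matching_poly:
  assumes "simple_graph G"
  shows "degree (matching_poly G) = card (verts G)" "lead_coeff (matching_poly G) = 1"
proof -
  let ?n = "card (verts G)"
  have "coeff (matching_poly G) ?n =
      (\<Sum>k\<le>?n div 2. if k = 0 then (- 1) ^ k * of_nat (matching_number G k) else 0)"
    unfolding matching_poly_def coeff_sum coeff_monom by (intro sum.cong) auto
  also have "\<dots> = 1" using matching_number_0[OF assms] by simp
  finally have top: "coeff (matching_poly G) ?n = 1" .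
  have "degree (matching_poly G) \<le> ?n"
    unfolding matching_poly_def
    by (intro degree_sum_le) (auto intro: order.trans[OF degree_monom_le])
  with top show "degree (matching_poly G) = ?n"
    by (metis le_antisym le_degree zero_neq_one)
  with top show "lead_coeff (matching_poly G) = 1" by simp
qed

lemma poly_matching_poly_eq_prod_roots:
  assumes "simple_graph G"
  shows "poly (matching_poly G) z = (\<Prod>w\<in>#proots (matching_poly G). z - w)"
proof -
  have "poly (matching_poly G) z = poly (\<Prod>w\<in>#proots (matching_poly G). [:- w, 1:]) z"
    using complex_poly_decompose_multiset[of "matching_poly G"] monic_matching_poly(2)[OF assms] by simp
  also have "\<dots> = (\<Prod>w\<in>#proots (matching_poly G). z - w)"
    by (simp add: poly_prod_mset image_mset.compositionality comp_def)
  finally show ?thesis .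
qed

text \<open>The left-hand side is, up to the factor \<open>x\<^bsup>2n\<^esup>\<close>, the product of the values of the matching polynomial
  at \<open>\<i> x\<close> and \<open>- \<i> x\<close>. Taking both points pairs the factors \<open>\<i> x - w\<close> and \<open>- \<i> x - w\<close> to \<open>x\<^sup>2 + w\<^sup>2\<close>, for
  each zero \<open>w\<close> separately.\<close>

lemma matching_gf_square_eq_prod_roots:
  fixes x :: real
  assumes "simple_graph G" "x > 0"
  shows "complex_of_real ((matching_gf (edges G) (1 / x\<^sup>2))\<^sup>2) =
    (\<Prod>w\<in>#proots (matching_poly G). 1 + w\<^sup>2 / of_real (x\<^sup>2))"
proof -
  let ?R = "proots (matching_poly G)" and ?n = "card (verts G)"
  \<comment> \<open>At this point \<open>- 1 / z\<^sup>2 = 1 / x\<^sup>2\<close> is a positive real number.\<close>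
  define z where "z = \<i> * complex_of_real x"
  have z: "z \<noteq> 0" "z\<^sup>2 = - of_real (x\<^sup>2)" using assms(2) by (auto simp: z_def power_mult_distrib)
  define q where "q = matching_gf (edges G) (1 / x\<^sup>2)"
  have gf: "matching_gf (edges G) (- 1 / z\<^sup>2) = complex_of_real q"
    unfolding q_def matching_gf_of_real[symmetric] by (simp add: z)
  have "(\<Prod>w\<in>#?R. z - w) * (\<Prod>w\<in>#?R. - z - w) = (z * - z) ^ ?n * (of_real q)\<^sup>2"
  proof -
    have "poly (matching_poly G) z = z ^ ?n * of_real q"
      using poly_matching_poly[OF assms(1) z(1)] unfolding gf .
    moreover have "poly (matching_poly G) (- z) = (- z) ^ ?n * of_real q"
      using poly_matching_poly[OF assms(1), of "- z"] z(1) unfolding power2_minus gf by simp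
    ultimately show ?thesis
      unfolding poly_matching_poly_eq_prod_roots[OF assms(1), symmetric] power_mult_distrib
      by (simp add: power2_eq_square mult_ac)
  qed
  moreover have "(\<Prod>w\<in>#R. z - w) * (\<Prod>w\<in>#R. - z - w) =
      (z * - z) ^ size R * (\<Prod>w\<in>#R. 1 + w\<^sup>2 / of_real (x\<^sup>2))" for R
  proof (induction R)
    case (add w R)
    have "(z - w) * (- z - w) = (z * - z) * (1 + w\<^sup>2 / of_real (x\<^sup>2))"
      using z assms(2) by (simp add: field_simps power2_eq_square)
    note eq = this
    have "(\<Prod>w\<in>#add_mset w R. z - w) * (\<Prod>w\<in>#add_mset w R. - z - w) =
        ((z - w) * (- z - w)) * ((\<Prod>w\<in>#R. z - w) * (\<Prod>w\<in>#R. - z - w))"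
      by (simp add: mult_ac)
    also have "\<dots> = (z * - z) ^ size (add_mset w R) *
        (\<Prod>w\<in>#add_mset w R. 1 + w\<^sup>2 / of_real (x\<^sup>2))"
      unfolding eq add.IH by (simp add: mult_ac)
    finally show ?case .
  qed simp
  moreover have "size ?R = ?n"
    by (simp add: size_proots_complex monic_matching_poly(1)[OF assms(1)])
  ultimately show ?thesis using z(1) by (simp add: q_def)
qed

lemma norm_prod_mset_le:
  fixes f :: "'a \<Rightarrow> complex"
  assumes "\<And>w. w \<in># R \<Longrightarrow> norm (f w) \<le> g w"
  shows "norm (\<Prod>w\<in>#R. f w) \<le> (\<Prod>w\<in>#R. g w)"
  using assms
proof (induction R)
  case (add w R)
  have w: "norm (f w) \<le> g w" and R: "norm (\<Prod>w\<in>#R. f w) \<le> (\<Prod>w\<in>#R. g w)"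
    using add by simp_all
  have "0 \<le> g w" using norm_ge_zero w by (rule order.trans)
  with w R have "norm (f w) * norm (\<Prod>w\<in>#R. f w) \<le> g w * (\<Prod>w\<in>#R. g w)"
    by (intro mult_mono) simp_all
  then show ?case by (simp add: norm_mult)
qed simp

text \<open>For arbitrary zeros, \<open>|1 + w\<^sup>2 / x\<^sup>2| \<le> 1 + |w|\<^sup>2 / x\<^sup>2\<close>; for real ones, treated next, this is an
  equality.\<close>

lemma matching_gf_square_le_prod_norm_roots:
  fixes x :: real
  assumes "simple_graph G" "x > 0"
  shows "(matching_gf (edges G) (1 / x\<^sup>2))\<^sup>2 \<le>
    (\<Prod>w\<in>#proots (matching_poly G). 1 + (cmod w)\<^sup>2 / x\<^sup>2)"
proof -
  have "(matching_gf (edges G) (1 / x\<^sup>2))\<^sup>2 =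
      norm (\<Prod>w\<in>#proots (matching_poly G). 1 + w\<^sup>2 / of_real (x\<^sup>2))"
    unfolding matching_gf_square_eq_prod_roots[OF assms, symmetric] norm_of_real by simp
  also have "\<dots> \<le> (\<Prod>w\<in>#proots (matching_poly G). 1 + (cmod w)\<^sup>2 / x\<^sup>2)"
    by (intro norm_prod_mset_le norm_triangle_le) (simp add: norm_divide norm_power)
  finally show ?thesis .
qed

lemma matching_gf_square_eq_prod_norm_roots:
  fixes x :: real
  assumes "simple_graph G" "x > 0" "\<And>w. poly (matching_poly G) w = 0 \<Longrightarrow> w \<in> \<real>"
  shows "(matching_gf (edges G) (1 / x\<^sup>2))\<^sup>2 =
    (\<Prod>w\<in>#proots (matching_poly G). 1 + (cmod w)\<^sup>2 / x\<^sup>2)"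
proof -
  have nz: "matching_poly G \<noteq> 0" using monic_matching_poly(2)[OF assms(1)] by auto
  have "complex_of_real (\<Prod>w\<in>#R. 1 + (cmod w)\<^sup>2 / x\<^sup>2) = (\<Prod>w\<in>#R. 1 + w\<^sup>2 / of_real (x\<^sup>2))"
    if "\<And>w. w \<in># R \<Longrightarrow> w \<in> \<real>" for R
    using that
  proof (induction R)
    case (add w R)
    have "of_real ((cmod w)\<^sup>2) = w\<^sup>2"
      using add.prems[of w] by (auto elim!: Reals_cases simp flip: of_real_power)
    then show ?case using add by simp
  qed simp
  from this[of "proots (matching_poly G)"] nz assms(3)
  have "complex_of_real (\<Prod>w\<in>#proots (matching_poly G). 1 + (cmod w)\<^sup>2 / x\<^sup>2) =
      complex_of_real ((matching_gf (edges G) (1 / x\<^sup>2))\<^sup>2)"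
    unfolding matching_gf_square_eq_prod_roots[OF assms(1,2)] by simp
  then show ?thesis by (simp only: of_real_eq_iff)
qed

text \<open>The product that determines the energy is at least the square of the generating function, for every
  graph. So a lower bound for the generating function of \<open>G\<close> bounds its energy from below, whereas the
  energy of \<open>H\<close> is bounded from above through the equality that real zeros provide.\<close>

lemma matching_energy_less:
  assumes "simple_graph G" "simple_graph H"
    and real_roots: "\<And>w. poly (matching_poly H) w = 0 \<Longrightarrow> w \<in> \<real>"
    and less: "\<And>y :: real. y > 0 \<Longrightarrow> matching_gf (edges H) y < matching_gf (edges G) y"
  shows "matching_energy H < matching_energy G"
  unfolding matching_energy_def
proof (rule sum_mset_less_of_prod_mset_less)
  fix x :: real assume x: "x > 0"
  have "(\<Prod>w\<in>#proots (matching_poly H). 1 + (cmod w)\<^sup>2 / x\<^sup>2) = (matching_gf (edges H) (1 / x\<^sup>2))\<^sup>2"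
    using matching_gf_square_eq_prod_norm_roots[OF assms(2) x real_roots] by simp
  also have "\<dots> < (matching_gf (edges G) (1 / x\<^sup>2))\<^sup>2"
    using x by (intro power_strict_mono less matching_gf_nonneg) auto
  also have "\<dots> \<le> (\<Prod>w\<in>#proots (matching_poly G). 1 + (cmod w)\<^sup>2 / x\<^sup>2)"
    by (rule matching_gf_square_le_prod_norm_roots[OF assms(1) x])
  finally show "(\<Prod>r\<in>#image_mset cmod (proots (matching_poly H)). 1 + r\<^sup>2 / x\<^sup>2) <
      (\<Prod>r\<in>#image_mset cmod (proots (matching_poly G)). 1 + r\<^sup>2 / x\<^sup>2)"
    by (simp add: image_mset.compositionality comp_def)
qed auto

section \<open>The zeros of the matching polynomial of \<open>B_graph n s\<close> are real\<close>

lemma simple_graph_B_graph: "n = s + t + 4 \<Longrightarrow> simple_graph (B_graph n s)"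
  by (auto simp: simple_graph_def B_graph_def card_insert_if)

text \<open>The matching polynomial of the path on \<open>k\<close> vertices (a rescaled Chebyshev polynomial of the second
  kind), as a function on the complex plane.\<close>

fun path_poly :: "nat \<Rightarrow> complex \<Rightarrow> complex" where
  "path_poly 0 z = 1"
| "path_poly (Suc 0) z = z"
| "path_poly (Suc (Suc k)) z = z * path_poly (Suc k) z - path_poly k z"

lemma path_poly_eq_path_gf: "z \<noteq> 0 \<Longrightarrow> path_poly k z = z ^ k * path_gf k (- 1 / z\<^sup>2)"
  by (induction k z rule: path_poly.induct) (simp_all add: field_simps power2_eq_square)

lemma path_poly_add:
  "path_poly (a + b + 2) z = path_poly (a + 1) z * path_poly (b + 1) z - path_poly a z * path_poly b z"
proof (induction a z rule: path_poly.induct)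
  case (3 a z)
  have "path_poly (Suc (Suc a) + b + 2) z = z * path_poly (Suc a + b + 2) z - path_poly (a + b + 2) z"
    by (simp add: eval_nat_numeral)
  then show ?case
    unfolding 3 by (simp add: algebra_simps)
qed (simp_all add: eval_nat_numeral algebra_simps)

lemma Im_inverse_neg: "Im w > 0 \<Longrightarrow> Im (1 / w) < 0"
proof -
  assume "Im w > 0"
  moreover from this have "(Re w)\<^sup>2 + (Im w)\<^sup>2 > 0" by (simp add: add_nonneg_pos)
  ultimately show ?thesis by (simp add: Im_divide)
qed

text \<open>The recurrence reads \<open>r\<^bsub>k+1\<^esub> = z - 1 / r\<^sub>k\<close> for the quotients \<open>r\<^sub>k\<close> of consecutive path polynomials,
  and \<open>r \<mapsto> z - 1 / r\<close> maps the upper half-plane into itself.\<close>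

lemma Im_path_poly_quotient_pos:
  assumes "Im z > 0"
  shows "path_poly k z \<noteq> 0 \<and> Im (path_poly (Suc k) z / path_poly k z) > 0"
proof (induction k)
  case (Suc k)
  let ?r = "path_poly (Suc k) z / path_poly k z"
  have nz: "path_poly (Suc k) z \<noteq> 0" using Suc by auto
  have "path_poly (Suc (Suc k)) z / path_poly (Suc k) z = z - 1 / ?r"
    using nz by (simp add: diff_divide_distrib)
  moreover have "Im (1 / ?r) < 0" by (rule Im_inverse_neg) (use Suc in simp)
  ultimately show ?case using nz assms by simp
qed (use assms in simp)

text \<open>The quotient is that of the path without an arbitrary vertex by the path itself. Its inverse is
  \<open>r\<^sub>a - 1 / r\<^bsub>b-1\<^esub>\<close> (or \<open>r\<^sub>a\<close> if \<open>b = 0\<close>), where \<open>r\<^sub>k\<close> again denotes the quotients of consecutive path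
  polynomials.\<close>

lemma Im_path_poly_product_quotient_neg:
  assumes "Im z > 0"
  shows "Im (path_poly a z * path_poly b z / path_poly (a + b + 1) z) < 0"
proof -
  note pos = Im_path_poly_quotient_pos[OF assms]
  let ?r = "path_poly (a + b + 1) z / (path_poly a z * path_poly b z)"
  have "Im ?r > 0"
  proof (cases b)
    case 0
    then show ?thesis using pos[of a] by simp
  next
    case (Suc b')
    have "path_poly (a + b + 1) z = path_poly (Suc a) z * path_poly b z - path_poly a z * path_poly b' z"
      using path_poly_add[of a b' z] Suc by simp
    then have "?r = path_poly (Suc a) z / path_poly a z - 1 / (path_poly b z / path_poly b' z)"
      using pos[of a] pos[of b] pos[of b'] by (simp add: field_simps)
    moreover have "Im (1 / (path_poly b z / path_poly b' z)) < 0"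
      by (rule Im_inverse_neg) (use pos[of b'] Suc in simp)
    ultimately show ?thesis using pos[of a] by simp
  qed
  then have "Im (1 / ?r) < 0" by (rule Im_inverse_neg)
  then show ?thesis by simp
qed

lemma poly_matching_poly_B_graph:
  assumes "n = s + t + 4" "z \<noteq> 0"
  shows "poly (matching_poly (B_graph n s)) z = z * path_poly (s + t + 3) z -
    (path_poly s z * path_poly (t + 2) z + path_poly (s + 1) z * path_poly (t + 1) z
       + path_poly (s + 2) z * path_poly t z)"
proof -
  define y where "y = - 1 / z\<^sup>2"
  have zy: "z ^ (k + 2) * y = - (z ^ k)" for k
    using assms(2) by (simp add: y_def power_add field_simps power2_eq_square)
  have n: "card (verts (B_graph n s)) = s + t + 4" using assms(1) by (simp add: B_graph_def)
  have "poly (matching_poly (B_graph n s)) z =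
     z ^ (s + t + 4) * path_gf (s + t + 3) y + z ^ (s + t + 2 + 2) * y *
      (path_gf s y * path_gf (t + 2) y + path_gf (s + 1) y * path_gf (t + 1) y
       + path_gf (s + 2) y * path_gf t y)"
    unfolding poly_matching_poly[OF simple_graph_B_graph[OF assms(1)] assms(2)] n y_def[symmetric]
      matching_gf_B_graph[OF assms(1)]
    by (simp add: algebra_simps del: path_gf.simps add_2_eq_Suc')
  also have "\<dots> = z * (z ^ (s + t + 3) * path_gf (s + t + 3) y) -
      ((z ^ s * path_gf s y) * (z ^ (t + 2) * path_gf (t + 2) y)
      + (z ^ (s + 1) * path_gf (s + 1) y) * (z ^ (t + 1) * path_gf (t + 1) y)
      + (z ^ (s + 2) * path_gf (s + 2) y) * (z ^ t * path_gf t y))"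
    unfolding zy by (simp add: power_add eval_nat_numeral algebra_simps del: path_gf.simps)
  finally show ?thesis
    unfolding y_def path_poly_eq_path_gf[OF assms(2), symmetric] .
qed

text \<open>Expanding at the vertex outside of the path, a zero \<open>z\<close> is the sum of three quotients as in the lemma
  \<open>Im_path_poly_product_quotient_neg\<close>. For \<open>z\<close> in the upper half-plane these have negative imaginary
  part, a contradiction.\<close>

lemma matching_poly_B_graph_real_roots:
  assumes "n = s + t + 4" "poly (matching_poly (B_graph n s)) w = 0"
  shows "w \<in> \<real>"
proof -
  have upper: "poly (matching_poly (B_graph n s)) z \<noteq> 0" if "Im z > 0" for z
  proof
    assume zero: "poly (matching_poly (B_graph n s)) z = 0"
    let ?c = "path_poly (s + t + 3) z"
    have c: "?c \<noteq> 0" using Im_path_poly_quotient_pos[OF that] by blast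
    have "z \<noteq> 0" using that by auto
    from zero[unfolded poly_matching_poly_B_graph[OF assms(1) this]]
    have "z = (path_poly s z * path_poly (t + 2) z + path_poly (s + 1) z * path_poly (t + 1) z
       + path_poly (s + 2) z * path_poly t z) / ?c"
      using c by (simp add: eq_divide_eq)
    also have "\<dots> = path_poly s z * path_poly (t + 2) z / ?c
       + path_poly (s + 1) z * path_poly (t + 1) z / ?c + path_poly (s + 2) z * path_poly t z / ?c"
      by (simp add: add_divide_distrib)
    finally have "Im z = Im (path_poly s z * path_poly (t + 2) z / ?c)
       + Im (path_poly (s + 1) z * path_poly (t + 1) z / ?c)
       + Im (path_poly (s + 2) z * path_poly t z / ?c)"
      by (metis plus_complex.sel(2))
    moreover have eq: "s + (t + 2) + 1 = s + t + 3" "s + 1 + (t + 1) + 1 = s + t + 3" "s + 2 + t + 1 = s + t + 3"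
      by simp_all
    note neg = Im_path_poly_product_quotient_neg[OF that]
    ultimately show False
      using that neg[of s "t + 2"] neg[of "s + 1" "t + 1"] neg[of "s + 2" t] unfolding eq by linarith
  qed
  have "poly (matching_poly (B_graph n s)) (- w) = 0"
    using assms(2) by (simp add: poly_matching_poly_minus)
  with upper[of w] upper[of "- w"] assms(2) have "Im w = 0" by (cases "Im w" "0::real" rule: linorder_cases) auto
  then show ?thesis by (simp add: complex_is_Real_iff)
qed

section \<open>Isomorphic graphs\<close>

lemma graph_iso_sym:
  assumes "graph_iso G H"
  shows "graph_iso H G"
proof -
  from assms obtain f where f: "bij_betw f (verts G) (verts H)"
    and e: "\<And>x y. x \<in> verts G \<Longrightarrow> y \<in> verts G \<Longrightarrow> {x, y} \<in> edges G \<longleftrightarrow> {f x, f y} \<in> edges H"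
    unfolding graph_iso_def by blast
  let ?g = "inv_into (verts G) f"
  have g: "bij_betw ?g (verts H) (verts G)" using f by (rule bij_betw_inv_into)
  have "{x, y} \<in> edges H \<longleftrightarrow> {?g x, ?g y} \<in> edges G" if "x \<in> verts H" "y \<in> verts H" for x y
    using e[of "?g x" "?g y"] that bij_betw_inv_into_right[OF f] bij_betwE[OF g] by simp
  with g show ?thesis unfolding graph_iso_def by blast
qed

lemma graph_iso_trans:
  assumes "graph_iso G H" "graph_iso H K"
  shows "graph_iso G K"
proof -
  from assms obtain f g where f: "bij_betw f (verts G) (verts H)"
    and ef: "\<And>x y. x \<in> verts G \<Longrightarrow> y \<in> verts G \<Longrightarrow> {x, y} \<in> edges G \<longleftrightarrow> {f x, f y} \<in> edges H"
    and g: "bij_betw g (verts H) (verts K)"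
    and eg: "\<And>x y. x \<in> verts H \<Longrightarrow> y \<in> verts H \<Longrightarrow> {x, y} \<in> edges H \<longleftrightarrow> {g x, g y} \<in> edges K"
    unfolding graph_iso_def by blast
  have "{x, y} \<in> edges G \<longleftrightarrow> {(g \<circ> f) x, (g \<circ> f) y} \<in> edges K"
    if "x \<in> verts G" "y \<in> verts G" for x y
    using that ef eg bij_betwE[OF f] by simp
  then show ?thesis unfolding graph_iso_def using bij_betw_trans[OF f g] by blast
qed

lemma graph_iso_imp_edges_eq_image:
  assumes "simple_graph G" "simple_graph H" "bij_betw f (verts G) (verts H)"
    and "\<And>x y. x \<in> verts G \<Longrightarrow> y \<in> verts G \<Longrightarrow> {x, y} \<in> edges G \<longleftrightarrow> {f x, f y} \<in> edges H"
  shows "edges H = (`) f ` edges G"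
proof (intro equalityI subsetI)
  fix e assume e: "e \<in> edges H"
  then have "e \<subseteq> verts H" "card e = 2" using assms(2) unfolding simple_graph_def by blast+
  then obtain a b where ab: "e = {a, b}" "a \<in> verts H" "b \<in> verts H"
    by (auto simp: card_2_iff)
  then obtain x y where "x \<in> verts G" "y \<in> verts G" "a = f x" "b = f y"
    using assms(3) unfolding bij_betw_def by blast
  with e ab assms(4)[of x y] have "{x, y} \<in> edges G" "e = f ` {x, y}" by simp_all
  then show "e \<in> (`) f ` edges G" by blast
next
  fix e assume "e \<in> (`) f ` edges G"
  then obtain e' where e': "e = f ` e'" "e' \<in> edges G" by blast
  then have "e' \<subseteq> verts G" "card e' = 2" using assms(1) unfolding simple_graph_def by blast+
  then obtain x y where "e' = {x, y}" "x \<in> verts G" "y \<in> verts G"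
    by (auto simp: card_2_iff)
  with e' assms(4)[of x y] show "e \<in> edges H" by simp
qed

lemma matching_number_graph_iso:
  assumes "simple_graph G" "simple_graph H" "graph_iso G H"
  shows "matching_number G k = matching_number H k"
proof -
  from assms(3) obtain f where f: "bij_betw f (verts G) (verts H)"
    and e: "\<And>x y. x \<in> verts G \<Longrightarrow> y \<in> verts G \<Longrightarrow> {x, y} \<in> edges G \<longleftrightarrow> {f x, f y} \<in> edges H"
    unfolding graph_iso_def by blast
  have inj: "inj_on f (verts G)" using f by (rule bij_betw_imp_inj_on)
  have E: "edges H = (`) f ` edges G"
    by (rule graph_iso_imp_edges_eq_image[OF assms(1,2) f e])
  have G: "\<Union>(edges G) \<subseteq> verts G" using assms(1) unfolding simple_graph_def by blast
  then have sub: "edges G \<subseteq> Pow (verts G)" by blast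
  have injE: "inj_on ((`) f) (edges G)"
    by (rule inj_on_subset[OF inj_on_image_Pow[OF inj] sub])
  have image_disjoint: "disjoint ((`) f ` M) \<longleftrightarrow> disjoint M" if "M \<subseteq> edges G" for M
  proof
    assume "disjoint M"
    moreover have "inj_on f (\<Union>M)" by (rule inj_on_subset[OF inj]) (use that G in blast)
    ultimately show "disjoint ((`) f ` M)" by (intro disjoint_image)
  next
    assume dis: "disjoint ((`) f ` M)"
    show "disjoint M"
    proof (rule disjointI)
      fix a b assume ab: "a \<in> M" "b \<in> M" "a \<noteq> b"
      then have "f ` a \<noteq> f ` b" using injE that by (meson inj_onD subsetD)
      with ab dis have "f ` a \<inter> f ` b = {}" by (meson disjointD imageI)
      then show "a \<inter> b = {}" by blast
    qed
  qed
  have "k_matchings H k = (`) ((`) f) ` k_matchings G k"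
  proof (intro equalityI subsetI)
    fix N assume N: "N \<in> k_matchings H k"
    then obtain M where M: "M \<subseteq> edges G" "N = (`) f ` M"
      unfolding k_matchings_def E by (auto simp: subset_image_iff)
    have "card N = card M" unfolding M(2) by (rule card_image[OF inj_on_subset[OF injE M(1)]])
    with N M image_disjoint[OF M(1)] have "M \<in> k_matchings G k"
      unfolding k_matchings_def by simp
    then show "N \<in> (`) ((`) f) ` k_matchings G k" unfolding M(2) by (rule imageI)
  next
    fix N assume "N \<in> (`) ((`) f) ` k_matchings G k"
    then obtain M where M: "M \<in> k_matchings G k" "N = (`) f ` M" by blast
    then have sub: "M \<subseteq> edges G" unfolding k_matchings_def by blast
    have "card N = card M" unfolding M(2) by (rule card_image[OF inj_on_subset[OF injE sub]])
    with M image_disjoint[OF sub] show "N \<in> k_matchings H k"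
      unfolding k_matchings_def E by auto
  qed
  moreover have "inj_on ((`) ((`) f)) (k_matchings G k)"
    by (rule inj_on_subset[OF inj_on_image_Pow[OF injE]]) (auto simp: k_matchings_def)
  ultimately show ?thesis unfolding matching_number_def by (simp add: card_image)
qed

lemma matching_energy_graph_iso:
  assumes "simple_graph G" "simple_graph H" "graph_iso G H"
  shows "matching_energy G = matching_energy H"
proof -
  have "card (verts G) = card (verts H)"
    using assms(3) unfolding graph_iso_def by (auto intro: bij_betw_same_card)
  then have "matching_poly G = matching_poly H"
    unfolding matching_poly_def using matching_number_graph_iso[OF assms] by simp
  then show ?thesis by (simp add: matching_energy_def)
qed

lemma edges_B_graph_iff:
  assumes "n = s + t + 4" "x < n" "y < n"
  shows "{x, y} \<in> edges (B_graph n s) \<longleftrightarrow>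
    (x < n - 1 \<and> y < n - 1 \<and> (y = x + 1 \<or> x = y + 1)) \<or>
    (x = n - 1 \<and> y \<in> {s, s + 1, s + 2}) \<or> (y = n - 1 \<and> x \<in> {s, s + 1, s + 2})"
proof -
  have "{x, y} \<in> {{i, i + 1} |i. i + 1 \<le> n - 2} \<longleftrightarrow>
      x < n - 1 \<and> y < n - 1 \<and> (y = x + 1 \<or> x = y + 1)"
    using assms(1) by (auto simp: doubleton_eq_iff)
  then show ?thesis
    unfolding B_graph_def by (auto simp: doubleton_eq_iff)
qed

lemma graph_iso_B_graph_reflect:
  assumes "n = s + t + 4"
  shows "graph_iso (B_graph n s) (B_graph n t)"
proof -
  \<comment> \<open>Reverse the path and fix the vertex \<open>n - 1\<close> outside of it.\<close>
  define f where "f i = (if i < n - 1 then n - 2 - i else i)" for i :: nat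
  have n: "n = t + s + 4" using assms by simp
  have f: "f x < n" "f (f x) = x" if "x < n" for x
    using that assms by (auto simp: f_def)
  have V: "verts (B_graph n s') = {..<n}" for s' by (simp add: B_graph_def)
  have "bij_betw f (verts (B_graph n s)) (verts (B_graph n t))"
    unfolding V by (rule bij_betwI[where g = f]) (use f in auto)
  moreover have "{x, y} \<in> edges (B_graph n s) \<longleftrightarrow> {f x, f y} \<in> edges (B_graph n t)"
    if xy: "x < n" "y < n" for x y
  proof -
    have path: "f i = n - 2 - i" "f i < n - 1" if "i < n - 1" for i
      using that assms by (auto simp: f_def)
    have w: "f (n - 1) = n - 1" by (simp add: f_def)
    have consecutive: "n - 2 - j = n - 2 - i + 1 \<longleftrightarrow> i = j + 1" if "i < n - 1" "j < n - 1" for i j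
      using that assms by linarith
    have attach: "n - 2 - i \<in> {t, t + 1, t + 2} \<longleftrightarrow> i \<in> {s, s + 1, s + 2}" if "i < n - 1" for i
      using that assms by auto
    note iff = edges_B_graph_iff[OF assms xy]
      edges_B_graph_iff[OF n f(1)[OF xy(1)] f(1)[OF xy(2)]]
    consider "x < n - 1" "y < n - 1" | "x < n - 1" "y = n - 1"
      | "x = n - 1" "y < n - 1" | "x = n - 1" "y = n - 1"
      using xy by linarith
    then show ?thesis
    proof cases
      case 1
      have "{x, y} \<in> edges (B_graph n s) \<longleftrightarrow> y = x + 1 \<or> x = y + 1"
        using iff(1) 1 by simp
      moreover have "{f x, f y} \<in> edges (B_graph n t) \<longleftrightarrow> f y = f x + 1 \<or> f x = f y + 1"
        using iff(2) path(2)[OF 1(1)] path(2)[OF 1(2)] by simp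
      ultimately show ?thesis
        unfolding path(1)[OF 1(1)] path(1)[OF 1(2)] using consecutive 1 by blast
    next
      case 2
      then show ?thesis unfolding iff using path[of x] w attach[of x] by auto
    next
      case 3
      then show ?thesis unfolding iff using path[of y] w attach[of y] by auto
    next
      case 4
      then show ?thesis unfolding iff using w assms by auto
    qed
  qed
  ultimately show ?thesis unfolding graph_iso_def V by blast
qed

section \<open>Bicyclic graphs of diameter two less than the order\<close>

text \<open>The surgery behind all shortcuts in a shortest walk. The case \<open>i = j\<close> is included so that also
  repeated vertices can be cut out.\<close>

lemma walk_replace_segment:
  assumes "walk G u v p" "i \<le> j" "j < length p" "walk G (p ! i) (p ! j) q"
  shows "walk G u v (take i p @ q @ drop (Suc j) p)"
proof -
  let ?R = "\<lambda>x y. {x, y} \<in> edges G"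
  have p: "p = take i p @ p ! i # drop (Suc i) p" "p = take j p @ p ! j # drop (Suc j) p"
    using assms(2,3) by (auto intro: id_take_nth_drop)
  note w = assms(1,4)[unfolded walk_def]
  have sp: "successively ?R p" using w by blast
  have 1: "successively ?R (take i p)" "take i p \<noteq> [] \<Longrightarrow> ?R (last (take i p)) (p ! i)"
  proof -
    have "successively ?R (take i p @ p ! i # drop (Suc i) p)" unfolding p(1)[symmetric] by (rule sp)
    then show "successively ?R (take i p)" "take i p \<noteq> [] \<Longrightarrow> ?R (last (take i p)) (p ! i)"
      by (auto simp: successively_append_iff)
  qed
  have 2: "successively ?R (drop (Suc j) p)" "drop (Suc j) p \<noteq> [] \<Longrightarrow> ?R (p ! j) (hd (drop (Suc j) p))"
  proof -
    have "successively ?R (take j p @ p ! j # drop (Suc j) p)" unfolding p(2)[symmetric] by (rule sp)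
    then show "successively ?R (drop (Suc j) p)"
        "drop (Suc j) p \<noteq> [] \<Longrightarrow> ?R (p ! j) (hd (drop (Suc j) p))"
      by (auto simp: successively_append_iff successively_Cons)
  qed
  have hd: "hd (take i p @ q @ drop (Suc j) p) = u"
  proof (cases "i = 0")
    case True
    then show ?thesis using w hd_conv_nth[of p] by simp
  next
    case False
    then show ?thesis using w by (simp add: hd_append)
  qed
  have last: "last (take i p @ q @ drop (Suc j) p) = v"
  proof (cases "drop (Suc j) p = []")
    case True
    then have "j = length p - 1" using assms(3) by simp
    then show ?thesis using True w last_conv_nth[of p] by simp
  next
    case False
    then show ?thesis using w by (simp add: last_append)
  qed
  have "set (take i p @ q @ drop (Suc j) p) \<subseteq> verts G"
    using w set_take_subset[of i p] set_drop_subset[of "Suc j" p] by auto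
  moreover have "successively ?R (take i p @ q @ drop (Suc j) p)"
    using w 1 2 by (auto simp: successively_append_iff)
  ultimately show ?thesis using hd last w unfolding walk_def by simp
qed

text \<open>No walk between two vertices of a shortest walk is shorter than the segment between them. Applied to
  walks on one, two and three vertices, this shows that the vertices of a shortest walk are distinct,
  that it has no chords, and that the neighbours of any outside vertex lie within distance two on it.\<close>

lemma shortest_walk_segment_le:
  assumes "walk G u v p" "length p = Suc (graph_dist G u v)"
    and "i \<le> j" "j < length p" "walk G (p ! i) (p ! j) q"
  shows "j - i < length q"
proof -
  let ?r = "take i p @ q @ drop (Suc j) p"
  have r: "walk G u v ?r" by (rule walk_replace_segment[OF assms(1,3,4,5)])
  then have "?r \<noteq> []" unfolding walk_def by blast
  then obtain l where l: "length ?r = Suc l" by (metis length_0_conv not0_implies_Suc)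
  with r have "graph_dist G u v \<le> l" unfolding graph_dist_def by (intro Least_le) blast
  with l assms(2) have "length p \<le> length ?r" by simp
  then show ?thesis using assms(3,4) by simp
qed

lemma obtain_shortest_walk:
  assumes "connected_graph G" "u \<in> verts G" "v \<in> verts G"
  obtains p where "walk G u v p" "length p = Suc (graph_dist G u v)"
proof -
  obtain p where p: "walk G u v p" using assms unfolding connected_graph_def by blast
  then have "p \<noteq> []" unfolding walk_def by blast
  then have "\<exists>l. \<exists>p. walk G u v p \<and> length p = Suc l"
    using p by (intro exI[of _ "length p - 1"] exI[of _ p]) simp
  then have "\<exists>p. walk G u v p \<and> length p = Suc (graph_dist G u v)"
    unfolding graph_dist_def by (rule LeastI_ex)
  then show ?thesis using that by blast
qed

lemma obtain_diametral_pair: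
  assumes "finite (verts G)" "verts G \<noteq> {}"
  obtains u v where "u \<in> verts G" "v \<in> verts G" "graph_dist G u v = graph_diameter G"
proof -
  let ?D = "{graph_dist G u v |u v. u \<in> verts G \<and> v \<in> verts G}"
  have "?D = (\<lambda>(u, v). graph_dist G u v) ` (verts G \<times> verts G)" by auto
  then have "finite ?D" "?D \<noteq> {}" using assms by auto
  then have "graph_diameter G \<in> ?D" unfolding graph_diameter_def by (rule Max_in)
  then show ?thesis using that by auto
qed

lemma card_3_span_2:
  fixes N :: "nat set"
  assumes "card N = 3" "\<And>i j. i \<in> N \<Longrightarrow> j \<in> N \<Longrightarrow> i \<le> j \<Longrightarrow> j \<le> i + 2"
  obtains s where "N = {s, s + 1, s + 2}"
proof
  let ?s = "Min N"
  have N: "finite N" "N \<noteq> {}" using assms(1) by (auto intro: card_ge_0_finite)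
  have sub: "N \<subseteq> {?s, ?s + 1, ?s + 2}"
  proof
    fix j assume j: "j \<in> N"
    have "?s \<le> j" "j \<le> ?s + 2" using N j assms(2)[OF Min_in[OF N] j] by auto
    then show "j \<in> {?s, ?s + 1, ?s + 2}" by auto
  qed
  have "card {?s, ?s + 1, ?s + 2} = 3" by simp
  then show "N = {?s, ?s + 1, ?s + 2}" using card_subset_eq[OF _ sub] assms(1) by simp
qed

text \<open>A shortest walk between vertices at distance \<open>n - 2\<close> leaves out just one vertex \<open>w\<close>. The graph has
  \<open>n - 2\<close> edges along the walk and none other between its vertices, so three edges end at \<open>w\<close>. Their
  other ends lie within distance two on the walk, hence are consecutive.\<close>

lemma bicyclic_class_graph_iso_B_graph:
  assumes "n \<ge> 4" and G: "G \<in> bicyclic_class n (n - 2)"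
  obtains s t where "n = s + t + 4" "graph_iso G (B_graph n s)"
proof -
  from G have simple: "simple_graph G" and con: "connected_graph G"
    and cardE: "card (edges G) = n + 1" and cardV: "card (verts G) = n"
    and diam: "graph_diameter G = n - 2"
    unfolding bicyclic_class_def bicyclic_def by auto
  have finV: "finite (verts G)" and edge: "\<And>e. e \<in> edges G \<Longrightarrow> e \<subseteq> verts G \<and> card e = 2"
    using simple unfolding simple_graph_def by auto
  obtain u v where uv: "u \<in> verts G" "v \<in> verts G" "graph_dist G u v = n - 2"
    using obtain_diametral_pair[OF finV] con diam unfolding connected_graph_def by metis
  obtain p where walk: "walk G u v p" and len': "length p = Suc (graph_dist G u v)"
    using obtain_shortest_walk[OF con uv(1,2)] .
  have len: "length p = n - 1" using len' uv(3) assms(1) by simp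
  have pV: "set p \<subseteq> verts G" using walk unfolding walk_def by blast
  have pV': "p ! i \<in> verts G" if "i < n - 1" for i using that len pV nth_mem[of i p] by auto
  note shortest = shortest_walk_segment_le[OF walk len', unfolded len]
  have step: "{p ! i, p ! Suc i} \<in> edges G" if "Suc i < n - 1" for i
    using walk that len unfolding walk_def by (auto dest: successively_nth)
  have inj: "p ! i \<noteq> p ! j" if "i < j" "j < n - 1" for i j
  proof
    assume "p ! i = p ! j"
    then have "walk G (p ! i) (p ! j) [p ! i]" using that pV' by (simp add: walk_def)
    from shortest[OF _ _ this] that show False by simp
  qed
  have chord: "j = Suc i" if "i < j" "j < n - 1" "{p ! i, p ! j} \<in> edges G" for i j
  proof -
    have "walk G (p ! i) (p ! j) [p ! i, p ! j]" using that pV' by (simp add: walk_def)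
    from shortest[OF _ _ this] that show ?thesis by simp
  qed
  have dist: "distinct p" using len by (metis distinct_conv_nth inj nat_neq_iff)
  have "card (verts G - set p) = 1"
    using card_Diff_subset[OF finite_set pV] distinct_card[OF dist] len cardV assms(1) by simp
  then obtain w where w: "verts G - set p = {w}" by (auto simp: card_1_singleton_iff)
  have wV: "w \<in> verts G" "w \<notin> set p" using w by auto
  have wp: "p ! i \<noteq> w" if "i < n - 1" for i using that len wV(2) nth_mem by metis
  define N where "N = {i. i < n - 1 \<and> {w, p ! i} \<in> edges G}"
  have span: "j \<le> i + 2" if "i \<in> N" "j \<in> N" "i \<le> j" for i j
  proof -
    have "walk G (p ! i) (p ! j) [p ! i, w, p ! j]"
      using that pV' wV by (simp add: walk_def N_def insert_commute)
    from shortest[OF that(3) _ this] that show ?thesis by (simp add: N_def)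
  qed
  let ?P = "(\<lambda>i. {p ! i, p ! Suc i}) ` {..<n - 2}" and ?W = "(\<lambda>i. {w, p ! i}) ` N"
  have cover: "\<exists>i<n - 1. x = p ! i" if "x \<in> verts G" "x \<noteq> w" for x
  proof -
    have "x \<in> set p" using that w by blast
    then show ?thesis using len by (metis in_set_conv_nth)
  qed
  have E: "edges G = ?P \<union> ?W"
  proof (intro equalityI subsetI)
    fix e assume e: "e \<in> edges G"
    then obtain x y where xy: "e = {x, y}" "x \<noteq> y" "x \<in> verts G" "y \<in> verts G"
      using edge[OF e] by (auto simp: card_2_iff)
    show "e \<in> ?P \<union> ?W"
    proof (cases "w \<in> e")
      case True
      then obtain z where z: "e = {w, z}" "z \<noteq> w" "z \<in> verts G" using xy by auto
      then obtain i where "i < n - 1" "z = p ! i" using cover by blast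
      then show ?thesis using z e by (auto simp: N_def)
    next
      case False
      then obtain i j where ij: "i < n - 1" "x = p ! i" "j < n - 1" "y = p ! j"
        using cover xy by (metis insertCI)
      then have "i \<noteq> j" using xy by auto
      then consider "i < j" | "j < i" by linarith
      then show ?thesis
      proof cases
        case 1
        then have "j = Suc i" using chord[OF 1 ij(3)] e ij xy by simp
        then show ?thesis using ij xy by auto
      next
        case 2
        then have "i = Suc j" using chord[OF 2 ij(1)] e ij xy by (simp add: insert_commute)
        then show ?thesis using ij xy by (auto simp: insert_commute)
      qed
    qed
  next
    fix e assume "e \<in> ?P \<union> ?W"
    then show "e \<in> edges G" using step by (auto simp: N_def)
  qed
  have nth_eq: "p ! i = p ! j \<longleftrightarrow> i = j" if "i < n - 1" "j < n - 1" for i j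
    using nth_eq_iff_index_eq[OF dist] that len by simp
  have "inj_on (\<lambda>i. {p ! i, p ! Suc i}) {..<n - 2}"
  proof (rule inj_onI)
    fix i j assume "i \<in> {..<n - 2}" "j \<in> {..<n - 2}" "{p ! i, p ! Suc i} = {p ! j, p ! Suc j}"
    then show "i = j" by (auto simp: doubleton_eq_iff nth_eq)
  qed
  then have "card ?P = n - 2" by (simp add: card_image)
  moreover have "inj_on (\<lambda>i. {w, p ! i}) N"
    by (rule inj_onI) (auto simp: doubleton_eq_iff N_def nth_eq)
  then have "card ?W = card N" by (rule card_image)
  moreover have "?P \<inter> ?W = {}"
  proof -
    have "w \<notin> e" if "e \<in> ?P" for e
    proof -
      obtain i where "e = {p ! i, p ! Suc i}" "i < n - 2" using \<open>e \<in> ?P\<close> by blast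
      moreover from this have "p ! i \<noteq> w" "p ! Suc i \<noteq> w" by (simp_all add: wp)
      ultimately show ?thesis by auto
    qed
    then show ?thesis by auto
  qed
  then have "card (edges G) = card ?P + card ?W"
    unfolding E by (intro card_Un_disjoint) (auto simp: N_def)
  ultimately have "card N = 3" using cardE assms(1) by simp
  then obtain s where s: "N = {s, s + 1, s + 2}" using card_3_span_2 span by metis
  have "s + 2 < n - 1" using s unfolding N_def by blast
  then have "n = s + (n - 4 - s) + 4" by simp
  then obtain t where t: "n = s + t + 4" by blast
  \<comment> \<open>The numbering of the vertices along the walk is an isomorphism from \<open>B_graph n s\<close>.\<close>
  define f where "f i = (if i = n - 1 then w else p ! i)" for i
  have V: "verts (B_graph n s) = {..<n}" by (simp add: B_graph_def)
  have "inj_on f {..<n}"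
    by (rule inj_onI) (auto simp: f_def nth_eq wp wp[symmetric] split: if_splits)
  moreover have "f ` {..<n} = verts G"
  proof (intro equalityI subsetI)
    fix x assume "x \<in> f ` {..<n}"
    then show "x \<in> verts G" using pV' wV by (auto simp: f_def)
  next
    fix x assume x: "x \<in> verts G"
    show "x \<in> f ` {..<n}"
    proof (cases "x = w")
      case True
      then show ?thesis using t by (intro image_eqI[where x = "n - 1"]) (auto simp: f_def)
    next
      case False
      with x cover obtain i where "i < n - 1" "x = p ! i" by blast
      then show ?thesis by (intro image_eqI[where x = i]) (auto simp: f_def)
    qed
  qed
  ultimately have "bij_betw f (verts (B_graph n s)) (verts G)" unfolding V bij_betw_def by blast
  moreover have "{x, y} \<in> edges (B_graph n s) \<longleftrightarrow> {f x, f y} \<in> edges G" if xy: "x < n" "y < n" for x y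
  proof -
    have N: "{w, p ! i} \<in> edges G \<longleftrightarrow> i \<in> {s, s + 1, s + 2}" if "i < n - 1" for i
      using s that unfolding N_def by blast
    have P: "{p ! i, p ! j} \<in> edges G \<longleftrightarrow> j = i + 1 \<or> i = j + 1" if "i < n - 1" "j < n - 1" for i j
    proof
      assume ij: "{p ! i, p ! j} \<in> edges G"
      then have "i \<noteq> j" using edge by force
      then consider "i < j" | "j < i" by linarith
      then show "j = i + 1 \<or> i = j + 1"
        using chord[of i j] chord[of j i] ij that by cases (auto simp: insert_commute)
    next
      assume "j = i + 1 \<or> i = j + 1"
      then show "{p ! i, p ! j} \<in> edges G" using step[of i] step[of j] that by (auto simp: insert_commute)
    qed
    have ww: "{w, w} \<notin> edges G" using edge by force
    consider "x < n - 1" "y < n - 1" | "x < n - 1" "y = n - 1" | "x = n - 1" "y < n - 1" | "x = n - 1" "y = n - 1"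
      using xy by linarith
    then show ?thesis
    proof cases
      case 1
      then show ?thesis unfolding edges_B_graph_iff[OF t xy] using P by (auto simp: f_def)
    next
      case 2
      then show ?thesis unfolding edges_B_graph_iff[OF t xy] using N[of x] by (auto simp: f_def insert_commute)
    next
      case 3
      then show ?thesis unfolding edges_B_graph_iff[OF t xy] using N[of y] by (auto simp: f_def)
    next
      case 4
      then show ?thesis unfolding edges_B_graph_iff[OF t xy] using ww t by (auto simp: f_def)
    qed
  qed
  ultimately have "graph_iso (B_graph n s) G" unfolding graph_iso_def V by blast
  then show ?thesis using that t graph_iso_sym by blast
qed

section \<open>The minimum of the matching energy\<close>

text \<open>With \<open>s \<le> t\<close> and \<open>s, t \<noteq> 1\<close>, either \<open>s = 0\<close>, or both paths attached to the diamond have at least two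
  vertices.\<close>

lemma matching_gf_B_graph_less:
  fixes y :: real
  assumes "n = s + t + 4" "s \<noteq> 1" "t \<noteq> 1" "n \<ge> 6" "s \<le> t" "y > 0"
  shows "matching_gf (edges (B_graph n 1)) y < matching_gf (edges (B_graph n s)) y"
proof (cases "s = 0")
  case True
  obtain b where b: "n = b + 6" using assms(4) by (metis add.commute le_Suc_ex)
  have "0 < y\<^sup>2 * (1 + y) * path_gf b y"
    using assms(6) path_gf_pos by (intro mult_pos_pos) auto
  then show ?thesis using True matching_gf_B_graph_end[OF b, of y] by simp
next
  case False
  with assms obtain a b where ab: "s = a + 2" "t = b + 2"
    by (metis One_nat_def Suc_1 add.commute le_Suc_ex less_2_cases_iff not_le not_less_eq_eq le_zero_eq)
  then have n: "n = a + b + 8" using assms(1) by simp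
  have "0 < y ^ 3 * (1 + y) * path_gf a y * path_gf b y"
    using assms(6) path_gf_pos by (intro mult_pos_pos) auto
  then show ?thesis using matching_gf_B_graph_interior[OF n, of y] ab(1) by simp
qed

theorem theorem4p7:
  fixes G :: "'a graph" and n :: nat
  assumes "n \<ge> 6"
    and "G \<in> bicyclic_class n (n - 2)"
    and "\<not> graph_iso G (B_graph n 1)"
  shows "matching_energy G > matching_energy (B_graph n 1)"
proof -
  obtain s' t' where st': "n = s' + t' + 4" "graph_iso G (B_graph n s')"
    using bicyclic_class_graph_iso_B_graph[OF _ assms(2)] assms(1) by auto
  have "\<exists>s t. n = s + t + 4 \<and> s \<le> t \<and> graph_iso G (B_graph n s)"
  proof (cases "s' \<le> t'")
    case False
    then have "n = t' + s' + 4" "t' \<le> s'" using st' by simp_all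
    then show ?thesis using graph_iso_trans[OF st'(2) graph_iso_B_graph_reflect[OF st'(1)]] by blast
  qed (use st' in blast)
  then obtain s t where st: "n = s + t + 4" "s \<le> t" and iso: "graph_iso G (B_graph n s)" by blast
  have "s \<noteq> 1" using iso assms(3) by blast
  moreover have "t \<noteq> 1"
    using graph_iso_trans[OF iso graph_iso_B_graph_reflect[OF st(1)]] assms(3) by blast
  ultimately have less: "matching_gf (edges (B_graph n 1)) y < matching_gf (edges (B_graph n s)) y"
    if "y > 0" for y :: real
    using matching_gf_B_graph_less st assms(1) that by blast
  have n1: "n = 1 + (n - 5) + 4" using assms(1) by simp
  have G: "simple_graph G" using assms(2) unfolding bicyclic_class_def bicyclic_def by blast
  have "matching_energy (B_graph n 1) < matching_energy (B_graph n s)"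
    by (rule matching_energy_less[OF simple_graph_B_graph[OF st(1)] simple_graph_B_graph[OF n1]
          matching_poly_B_graph_real_roots[OF n1] less])
  then show ?thesis
    unfolding matching_energy_graph_iso[OF G simple_graph_B_graph[OF st(1)] iso] .
qed

end
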